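(* Let $T_{a,w}$ be a weighted translation on $L^p(G)$, $1\le p<\infty$, and let $A\subset\mathbb{N}$ with $\overline{\mathrm{dens}}(A)=1$. There exists a unique (up to measure zero) measurable set $M_A\subseteq G$ such that $\overline{X_{0,A}(T_{a,w})}=L^p(M_A)$. Moreover, up to sets of measure zero, $M_Aa^n\subseteq M_A$ for all $n\in\mathbb{N}$. In addition, if $T_{a,w}$ is invertible, then, up to sets of measure zero, $M_Aa^n=M_A$ for all $n\in\mathbb{Z}$.
   Context: $G$ is a second countable locally compact Hausdorff group with a right invariant Haar measure $\lambda$; $L^p(G)$ is the complex Lebesgue space with respect to $\lambda$. For measurable $Y\subseteq G$, $L^p(Y)$ is identified with the closed subspace of $L^p(G)$ of functions vanishing a.e. outside $Y$. A weight on $G$ is a bounded continuous function $w:G\to(0,\infty)$. For $a\in G$, $(T_af)(x):=f(xa^{-1})$ and the weighted translation is $T_{a,w}f:=w\,T_af$ for $f\in L^p(G)$; it is invertible when $w^{-1}\in L^\infty(G)$. For $A\subset\mathbb{N}=\{1,2,\dots\}$, $\overline{\mathrm{dens}}(A)=\limsup_{n\to\infty}\frac{\mathrm{card}(A\cap[1,n])}{n}$; $\lim_{n\in A}$ means the limit as $n\to\infty$ with $n\in A$. $X_{0,A}(T_{a,w})=\{x\in L^p(G):\lim_{n\in A}T_{a,w}^nx=0\}$, and the closure is in the norm topology. *)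

theory Defs
  imports "HOL-Analysis.Analysis" "HOL-Algebra.Coset"
begin

locale topological_group = group G for G (structure) +
  fixes \<T> :: "'a topology"
  assumes topspace_eq: "topspace \<T> = carrier G"
    and continuous_mult: "continuous_map (prod_topology \<T> \<T>) \<T> (\<lambda>(x, y). x \<otimes> y)"
    and continuous_inv: "continuous_map \<T> \<T> (\<lambda>x. inv x)"

text \<open>
  Regularity is not listed: on a second countable locally compact Hausdorff group every Borel
  measure that is finite on compact sets is regular.
\<close>

definition right_haar_measure :: "('a, 'b) monoid_scheme \<Rightarrow> 'a topology \<Rightarrow> 'a measure \<Rightarrow> bool" where
  "right_haar_measure G \<T> \<mu> \<longleftrightarrow>
     sets \<mu> = sets (sigma (topspace \<T>) {U. openin \<T> U}) \<and>
     emeasure \<mu> (space \<mu>) \<noteq> 0 \<and>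
     (\<forall>K. compactin \<T> K \<longrightarrow> emeasure \<mu> K < \<infinity>) \<and>
     (\<forall>B \<in> sets \<mu>. \<forall>g \<in> carrier G. emeasure \<mu> (B #>\<^bsub>G\<^esub> g) = emeasure \<mu> B)"

text \<open>
  Elements of \<open>L\<^sup>p\<close> are given by representing functions, without passing to classes modulo
  equality almost everywhere. Accordingly \<open>Lp_norm\<close> is a seminorm vanishing exactly on the
  functions that are zero almost everywhere, and \<open>Lp_topology\<close> is the topology it induces.
  Within \<open>Lp_space\<close>, open sets, closures and the sets \<open>Lp_on\<close> below are closed under equality
  almost everywhere, so they correspond to subsets of the Banach space of classes.
\<close>

definition Lp_space :: "'a measure \<Rightarrow> real \<Rightarrow> ('a \<Rightarrow> complex) set" where
  "Lp_space \<mu> p = {f \<in> borel_measurable \<mu>. integrable \<mu> (\<lambda>x. norm (f x) powr p)}"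

definition Lp_norm :: "'a measure \<Rightarrow> real \<Rightarrow> ('a \<Rightarrow> complex) \<Rightarrow> real" where
  "Lp_norm \<mu> p f = (LINT x|\<mu>. norm (f x) powr p) powr (1 / p)"

definition Lp_topology :: "'a measure \<Rightarrow> real \<Rightarrow> ('a \<Rightarrow> complex) topology" where
  "Lp_topology \<mu> p = topology (\<lambda>U. U \<subseteq> Lp_space \<mu> p \<and>
     (\<forall>f \<in> U. \<exists>e > 0. \<forall>g \<in> Lp_space \<mu> p. Lp_norm \<mu> p (\<lambda>x. g x - f x) < e \<longrightarrow> g \<in> U))"

lemma openin_Lp_topology:
  "openin (Lp_topology \<mu> p) U \<longleftrightarrow> U \<subseteq> Lp_space \<mu> p \<and>
     (\<forall>f \<in> U. \<exists>e > 0. \<forall>g \<in> Lp_space \<mu> p. Lp_norm \<mu> p (\<lambda>x. g x - f x) < e \<longrightarrow> g \<in> U)"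
proof -
  define P where "P = (\<lambda>U. U \<subseteq> Lp_space \<mu> p \<and>
     (\<forall>f \<in> U. \<exists>e > 0. \<forall>g \<in> Lp_space \<mu> p. Lp_norm \<mu> p (\<lambda>x. g x - f x) < e \<longrightarrow> g \<in> U))"
  have "P (S \<inter> T)" if S: "P S" and T: "P T" for S T
    unfolding P_def
  proof (intro conjI ballI)
    show "S \<inter> T \<subseteq> Lp_space \<mu> p" using S unfolding P_def by blast
  next
    fix f assume f: "f \<in> S \<inter> T"
    obtain d where "d > 0" "\<forall>g \<in> Lp_space \<mu> p. Lp_norm \<mu> p (\<lambda>x. g x - f x) < d \<longrightarrow> g \<in> S"
      using S f unfolding P_def by blast
    moreover obtain e where "e > 0" "\<forall>g \<in> Lp_space \<mu> p. Lp_norm \<mu> p (\<lambda>x. g x - f x) < e \<longrightarrow> g \<in> T"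
      using T f unfolding P_def by blast
    ultimately show "\<exists>e > 0. \<forall>g \<in> Lp_space \<mu> p. Lp_norm \<mu> p (\<lambda>x. g x - f x) < e \<longrightarrow> g \<in> S \<inter> T"
      by (intro exI[of _ "min d e"]) auto
  qed
  moreover have "P (\<Union>\<K>)" if "\<forall>K \<in> \<K>. P K" for \<K>
    using that unfolding P_def by (meson Union_iff Union_least)
  ultimately have "istopology P" unfolding istopology_def by blast
  then show ?thesis unfolding Lp_topology_def P_def by (simp add: topology_inverse')
qed

lemma topspace_Lp_topology: "topspace (Lp_topology \<mu> p) = Lp_space \<mu> p"
proof -
  have "openin (Lp_topology \<mu> p) (Lp_space \<mu> p)"
    unfolding openin_Lp_topology by (auto intro: exI[of _ 1])
  then show ?thesis
    unfolding topspace_def using openin_Lp_topology[of \<mu> p] by blast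
qed

definition Lp_on :: "'a measure \<Rightarrow> real \<Rightarrow> 'a set \<Rightarrow> ('a \<Rightarrow> complex) set" where
  "Lp_on \<mu> p Y = {f \<in> Lp_space \<mu> p. AE x in \<mu>. x \<notin> Y \<longrightarrow> f x = 0}"

text \<open>
  Linearity is required up to equality almost everywhere; together with the norm bound it makes
  \<open>S\<close> respect equality almost everywhere.
\<close>

definition Lp_bounded_operator ::
    "'a measure \<Rightarrow> real \<Rightarrow> (('a \<Rightarrow> complex) \<Rightarrow> ('a \<Rightarrow> complex)) \<Rightarrow> bool" where
  "Lp_bounded_operator \<mu> p S \<longleftrightarrow>
     (\<forall>f \<in> Lp_space \<mu> p. S f \<in> Lp_space \<mu> p) \<and>
     (\<forall>f \<in> Lp_space \<mu> p. \<forall>g \<in> Lp_space \<mu> p. AE x in \<mu>. S (\<lambda>y. f y + g y) x = S f x + S g x) \<and>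
     (\<forall>c. \<forall>f \<in> Lp_space \<mu> p. AE x in \<mu>. S (\<lambda>y. c * f y) x = c * S f x) \<and>
     (\<exists>C. \<forall>f \<in> Lp_space \<mu> p. Lp_norm \<mu> p (S f) \<le> C * Lp_norm \<mu> p f)"

definition Lp_invertible ::
    "'a measure \<Rightarrow> real \<Rightarrow> (('a \<Rightarrow> complex) \<Rightarrow> ('a \<Rightarrow> complex)) \<Rightarrow> bool" where
  "Lp_invertible \<mu> p T \<longleftrightarrow>
     (\<exists>S. Lp_bounded_operator \<mu> p S \<and>
        (\<forall>f \<in> Lp_space \<mu> p. (AE x in \<mu>. S (T f) x = f x) \<and> (AE x in \<mu>. T (S f) x = f x)))"

definition weight :: "'a topology \<Rightarrow> ('a \<Rightarrow> real) \<Rightarrow> bool" where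
  "weight \<T> w \<longleftrightarrow> continuous_map \<T> euclideanreal w \<and>
     bounded (w ` topspace \<T>) \<and> (\<forall>x \<in> topspace \<T>. 0 < w x)"

definition weighted_translation ::
    "('a, 'b) monoid_scheme \<Rightarrow> 'a \<Rightarrow> ('a \<Rightarrow> real) \<Rightarrow> ('a \<Rightarrow> complex) \<Rightarrow> ('a \<Rightarrow> complex)" where
  "weighted_translation G a w f = (\<lambda>x. complex_of_real (w x) * f (x \<otimes>\<^bsub>G\<^esub> inv\<^bsub>G\<^esub> a))"

definition upper_density :: "nat set \<Rightarrow> ereal" where
  "upper_density A = limsup (\<lambda>n. ereal (real (card (A \<inter> {1..n})) / real n))"

definition X0 ::
    "'a measure \<Rightarrow> real \<Rightarrow> nat set \<Rightarrow> (('a \<Rightarrow> complex) \<Rightarrow> ('a \<Rightarrow> complex)) \<Rightarrow> ('a \<Rightarrow> complex) set" where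
  "X0 \<mu> p A T = {f \<in> Lp_space \<mu> p.
     limitin (Lp_topology \<mu> p) (\<lambda>n. (T ^^ n) f) (\<lambda>x. 0) (inf sequentially (principal A))}"

definition subset_ae :: "'a measure \<Rightarrow> 'a set \<Rightarrow> 'a set \<Rightarrow> bool" where
  "subset_ae \<mu> A B \<longleftrightarrow> A - B \<in> null_sets \<mu>"

definition eq_ae :: "'a measure \<Rightarrow> 'a set \<Rightarrow> 'a set \<Rightarrow> bool" where
  "eq_ae \<mu> A B \<longleftrightarrow> subset_ae \<mu> A B \<and> subset_ae \<mu> B A"

end

theory Submission
  imports Defs
begin

text \<open>
  The subspace \<open>X0\<close> is solid: a measurable function that is pointwise dominated by a member is
  itself a member, because \<open>T\<close> multiplies by a positive weight and moves points, so that
  \<open>norm g \<le> norm f\<close> is inherited by all iterates. The closure of a solid linear subspace of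
  \<open>L\<^sup>p\<close> over a sigma-finite measure has the form \<open>L\<^sup>p(M)\<close>
  (\<open>closure_solid_subspace\<close>): \<open>M\<close> is a countable union of supports of members that contains the
  support of every member up to a null set, and a function vanishing off \<open>M\<close> is the limit of its
  truncations to the sets where it is dominated by a multiple of a finite sum of absolute values
  of the chosen members. The Haar measure is sigma-finite, since a second countable locally
  compact space is covered by countably many open sets contained in compact ones. That
  \<open>L\<^sup>p(M)\<close> determines \<open>M\<close> is seen by testing with indicators of sets of finite measure.

  Translation invariance of \<open>M\<close> reflects invariance of \<open>X0\<close>. Since \<open>T\<close> is bounded and commutes
  with its own powers, \<open>T\<^sup>n (T f) = T (T\<^sup>n f)\<close> tends to \<open>0\<close> along \<open>A\<close> whenever \<open>T\<^sup>n f\<close>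
  does, so \<open>T\<close> maps \<open>X0\<close> to itself (\<open>W_X0\<close>). The support of \<open>T f\<close> is the support of \<open>f\<close>
  translated by \<open>a\<close>, hence \<open>M #> a\<close> lies in \<open>M\<close>. If \<open>T\<close> has a bounded inverse, the same argument
  for the inverse (\<open>X0_preimage\<close>) gives that \<open>M #> inv a\<close> lies in \<open>M\<close>
  (\<open>translation_invariant_support\<close>), and the two inclusions generate the statement for all
  integer powers.
\<close>

section \<open>The norm and the topology of \<open>L\<^sup>p\<close>\<close>

lemma powr_convex_combination:
  fixes x y t p :: real
  assumes "1 \<le> p" "0 \<le> t" "t \<le> 1" "0 \<le> x" "0 \<le> y"
  shows "((1 - t) * x + t * y) powr p \<le> (1 - t) * x powr p + t * y powr p"
proof -
  have shrink: "(s * z) powr p \<le> s * z powr p" if "0 \<le> s" "s \<le> 1" "0 \<le> z" for s z :: real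
  proof -
    have "s powr p \<le> s"
      using powr_mono'[of 1 p s] that assms(1) by (cases "s = 0") auto
    then show ?thesis
      using that by (simp add: powr_mult mult_right_mono)
  qed
  consider "x = 0" | "y = 0" | "0 < x" "0 < y" using assms by linarith
  then show ?thesis
  proof cases
    case 1 then show ?thesis using shrink[of t y] assms by simp
  next
    case 2 then show ?thesis using shrink[of "1 - t" x] assms by simp
  next
    case 3 then show ?thesis
      using convex_onD[OF powr_convex[OF assms(1)], of t x y] assms by simp
  qed
qed

text \<open>
  Writing \<open>norm u + norm v\<close> as \<open>a + b\<close> times a convex combination of \<open>norm u / a\<close> and
  \<open>norm v / b\<close> gives the pointwise form of Minkowski's inequality, in which \<open>a\<close> and \<open>b\<close> stand
  for the norms of the two summands.
\<close>

lemma powr_norm_add_le: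
  fixes u v :: complex and a b p :: real
  assumes "1 \<le> p" "0 < a" "0 < b"
  shows "norm (u + v) powr p \<le>
    (a + b) powr p * (a / (a + b) * (norm u powr p / a powr p) + b / (a + b) * (norm v powr p / b powr p))"
proof -
  define t where "t = b / (a + b)"
  have t: "0 \<le> t" "t \<le> 1" "1 - t = a / (a + b)"
    using assms by (auto simp: t_def field_simps)
  have eq: "norm u + norm v = (a + b) * ((1 - t) * (norm u / a) + t * (norm v / b))"
    using assms unfolding t(3) by (simp add: t_def distrib_left)
  have "norm (u + v) powr p \<le> (norm u + norm v) powr p"
    using assms by (intro powr_mono2 norm_triangle_ineq) auto
  also have "\<dots> = (a + b) powr p * ((1 - t) * (norm u / a) + t * (norm v / b)) powr p"
    unfolding eq by (rule powr_mult)
  also have "\<dots> \<le> (a + b) powr p * ((1 - t) * (norm u / a) powr p + t * (norm v / b) powr p)"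
    using t assms by (intro mult_left_mono powr_convex_combination) auto
  finally show ?thesis
    using assms unfolding t(3) by (simp add: t_def powr_divide)
qed

locale Lp_exponent =
  fixes \<mu> :: "'a measure" and p :: real
  assumes p_ge_1: "1 \<le> p"
begin

lemma p_pos: "0 < p" using p_ge_1 by simp

lemma Lp_spaceD [measurable_dest]: "f \<in> Lp_space \<mu> p \<Longrightarrow> f \<in> borel_measurable \<mu>"
  by (simp add: Lp_space_def)

lemma Lp_space_integrable: "f \<in> Lp_space \<mu> p \<Longrightarrow> integrable \<mu> (\<lambda>x. norm (f x) powr p)"
  by (simp add: Lp_space_def)

lemma integral_powr_nonneg: "0 \<le> (LINT x|\<mu>. norm (f x :: complex) powr p)"
  by (rule integral_nonneg_AE) auto

lemma Lp_norm_nonneg [simp]: "0 \<le> Lp_norm \<mu> p f"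
  by (simp add: Lp_norm_def)

lemma Lp_norm_powr: "Lp_norm \<mu> p f powr p = (LINT x|\<mu>. norm (f x) powr p)"
  using p_pos integral_powr_nonneg[of f] by (simp add: Lp_norm_def powr_powr)

lemma Lp_norm_le_iff:
  assumes "0 \<le> c"
  shows "Lp_norm \<mu> p f \<le> c \<longleftrightarrow> (LINT x|\<mu>. norm (f x) powr p) \<le> c powr p"
  unfolding Lp_norm_powr[symmetric] using assms p_pos Lp_norm_nonneg[of f]
  by (metis linorder_not_less powr_less_mono2 powr_mono2 less_eq_real_def)

lemma Lp_norm_zero [simp]: "Lp_norm \<mu> p (\<lambda>x. 0) = 0"
  using p_pos by (simp add: Lp_norm_def)

lemma zero_in_Lp_space [simp]: "(\<lambda>x. 0) \<in> Lp_space \<mu> p"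
  by (simp add: Lp_space_def)

lemma Lp_norm_eq_0_iff:
  assumes "f \<in> Lp_space \<mu> p"
  shows "Lp_norm \<mu> p f = 0 \<longleftrightarrow> (AE x in \<mu>. f x = 0)"
proof -
  have "Lp_norm \<mu> p f = 0 \<longleftrightarrow> (LINT x|\<mu>. norm (f x) powr p) = 0"
    by (simp add: Lp_norm_def)
  also have "\<dots> \<longleftrightarrow> (AE x in \<mu>. norm (f x) powr p = 0)"
    by (intro integral_nonneg_eq_0_iff_AE Lp_space_integrable assms) auto
  finally show ?thesis by simp
qed

lemma Lp_space_dominated:
  assumes "f \<in> Lp_space \<mu> p" "g \<in> borel_measurable \<mu>" "AE x in \<mu>. norm (g x) \<le> norm (f x)"
  shows "g \<in> Lp_space \<mu> p"
proof -
  have "integrable \<mu> (\<lambda>x. norm (g x) powr p)"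
    using Lp_space_integrable[OF assms(1)]
  proof (rule Bochner_Integration.integrable_bound)
    show "AE x in \<mu>. norm (norm (g x) powr p) \<le> norm (norm (f x) powr p)"
      using assms(3) by eventually_elim (use p_pos in \<open>auto intro: powr_mono2\<close>)
  qed (use assms in measurable)
  then show ?thesis using assms by (simp add: Lp_space_def)
qed

lemma Lp_norm_mono:
  assumes f: "f \<in> Lp_space \<mu> p" and g: "g \<in> borel_measurable \<mu>"
    and le: "AE x in \<mu>. norm (g x) \<le> norm (f x)"
  shows "Lp_norm \<mu> p g \<le> Lp_norm \<mu> p f"
proof -
  have "(LINT x|\<mu>. norm (g x) powr p) \<le> (LINT x|\<mu>. norm (f x) powr p)"
  proof (rule integral_mono_AE)
    show "AE x in \<mu>. norm (g x) powr p \<le> norm (f x) powr p"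
      using le by eventually_elim (use p_pos in \<open>auto intro: powr_mono2\<close>)
  qed (use Lp_space_dominated[OF f g le] f in \<open>auto intro: Lp_space_integrable\<close>)
  then show ?thesis by (simp add: Lp_norm_le_iff Lp_norm_powr)
qed

lemma Lp_norm_cong_AE:
  assumes "f \<in> borel_measurable \<mu>" "g \<in> borel_measurable \<mu>" "AE x in \<mu>. f x = g x"
  shows "Lp_norm \<mu> p f = Lp_norm \<mu> p g"
proof -
  have "(LINT x|\<mu>. norm (f x) powr p) = (LINT x|\<mu>. norm (g x) powr p)"
    by (rule integral_cong_AE) (use assms in auto)
  then show ?thesis by (simp add: Lp_norm_def)
qed

lemma Lp_space_scale:
  assumes "f \<in> Lp_space \<mu> p"
  shows "(\<lambda>x. c * f x) \<in> Lp_space \<mu> p"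
  using assms by (auto simp: Lp_space_def norm_mult powr_mult)

lemma Lp_norm_scale: "Lp_norm \<mu> p (\<lambda>x. c * f x) = norm c * Lp_norm \<mu> p f"
  using p_pos integral_powr_nonneg[of f]
  by (simp add: Lp_norm_def norm_mult powr_mult powr_powr)

lemma Lp_space_add:
  assumes f: "f \<in> Lp_space \<mu> p" and g: "g \<in> Lp_space \<mu> p"
  shows "(\<lambda>x. f x + g x) \<in> Lp_space \<mu> p"
proof -
  have "integrable \<mu> (\<lambda>x. norm (f x + g x) powr p)"
  proof (rule Bochner_Integration.integrable_bound)
    show "integrable \<mu> (\<lambda>x. (1 + 1) powr p * (1 / (1 + 1) * (norm (f x) powr p / 1 powr p)
        + 1 / (1 + 1) * (norm (g x) powr p / 1 powr p)))"
      using f g by (auto intro!: integrable_mult_right Bochner_Integration.integrable_add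
          Lp_space_integrable)
    show "AE x in \<mu>. norm (norm (f x + g x) powr p) \<le> norm ((1 + 1) powr p * (1 / (1 + 1) *
        (norm (f x) powr p / 1 powr p) + 1 / (1 + 1) * (norm (g x) powr p / 1 powr p)))"
      using powr_norm_add_le[OF p_ge_1, of 1 1]
      by (intro AE_I2) (simp only: real_norm_def abs_of_nonneg powr_ge_zero order_trans[OF _ abs_ge_self])
  qed (use f g in measurable)
  then show ?thesis using f g by (auto simp: Lp_space_def)
qed

text \<open>
  Integrating \<open>powr_norm_add_le\<close> with \<open>a\<close> and \<open>b\<close> slightly larger than the two norms avoids the
  division by a norm that may vanish.
\<close>

lemma Minkowski_inequality:
  assumes f: "f \<in> Lp_space \<mu> p" and g: "g \<in> Lp_space \<mu> p"
  shows "Lp_norm \<mu> p (\<lambda>x. f x + g x) \<le> Lp_norm \<mu> p f + Lp_norm \<mu> p g"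
proof (rule field_le_epsilon)
  fix e :: real assume e: "0 < e"
  define a where "a = Lp_norm \<mu> p f + e / 2"
  define b where "b = Lp_norm \<mu> p g + e / 2"
  have ab: "0 < a" "0 < b" using e by (auto simp: a_def b_def add_nonneg_pos)
  have If: "(LINT x|\<mu>. norm (f x) powr p) \<le> a powr p"
    using e ab by (subst Lp_norm_le_iff[symmetric]) (auto simp: a_def)
  have Ig: "(LINT x|\<mu>. norm (g x) powr p) \<le> b powr p"
    using e ab by (subst Lp_norm_le_iff[symmetric]) (auto simp: b_def)
  note int = Lp_space_integrable[OF f] Lp_space_integrable[OF g]
  have "(LINT x|\<mu>. norm (f x + g x) powr p) \<le> (LINT x|\<mu>. (a + b) powr p *
      (a / (a + b) * (norm (f x) powr p / a powr p) + b / (a + b) * (norm (g x) powr p / b powr p)))"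
    using int Lp_space_integrable[OF Lp_space_add[OF f g]]
    by (intro integral_mono powr_norm_add_le p_ge_1 ab) auto
  also have "\<dots> = (a + b) powr p * (a / (a + b) * ((LINT x|\<mu>. norm (f x) powr p) / a powr p)
      + b / (a + b) * ((LINT x|\<mu>. norm (g x) powr p) / b powr p))"
    using int by simp
  also have "\<dots> \<le> (a + b) powr p * (a / (a + b) * 1 + b / (a + b) * 1)"
    using If Ig ab by (intro mult_left_mono add_mono) auto
  also have "\<dots> = (a + b) powr p"
    using ab by (simp add: add_divide_distrib[symmetric])
  finally have "Lp_norm \<mu> p (\<lambda>x. f x + g x) \<le> a + b"
    using ab by (simp add: Lp_norm_le_iff)
  then show "Lp_norm \<mu> p (\<lambda>x. f x + g x) \<le> Lp_norm \<mu> p f + Lp_norm \<mu> p g + e"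
    by (simp add: a_def b_def)
qed

lemma Lp_space_diff:
  assumes "f \<in> Lp_space \<mu> p" "g \<in> Lp_space \<mu> p"
  shows "(\<lambda>x. f x - g x) \<in> Lp_space \<mu> p"
  using Lp_space_add[OF assms(1) Lp_space_scale[OF assms(2), of "-1"]] by simp

text \<open>
  The topology is given by a neighbourhood condition on open sets; that balls are open, which
  needs the triangle inequality, is what makes closures and limits expressible by the norm.
\<close>

lemma openin_Lp_ball:
  assumes f: "f \<in> Lp_space \<mu> p"
  shows "openin (Lp_topology \<mu> p) {g \<in> Lp_space \<mu> p. Lp_norm \<mu> p (\<lambda>x. g x - f x) < e}"
  unfolding openin_Lp_topology
proof (intro conjI ballI)
  fix g assume g: "g \<in> {g \<in> Lp_space \<mu> p. Lp_norm \<mu> p (\<lambda>x. g x - f x) < e}"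
  show "\<exists>d>0. \<forall>h\<in>Lp_space \<mu> p. Lp_norm \<mu> p (\<lambda>x. h x - g x) < d \<longrightarrow>
      h \<in> {g \<in> Lp_space \<mu> p. Lp_norm \<mu> p (\<lambda>x. g x - f x) < e}"
  proof (intro exI[of _ "e - Lp_norm \<mu> p (\<lambda>x. g x - f x)"] conjI ballI impI)
    fix h assume h: "h \<in> Lp_space \<mu> p" "Lp_norm \<mu> p (\<lambda>x. h x - g x) < e - Lp_norm \<mu> p (\<lambda>x. g x - f x)"
    have "Lp_norm \<mu> p (\<lambda>x. h x - f x) \<le> Lp_norm \<mu> p (\<lambda>x. h x - g x) + Lp_norm \<mu> p (\<lambda>x. g x - f x)"
      using Minkowski_inequality[OF Lp_space_diff[of h g] Lp_space_diff[of g f]] f g h by simp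
    then show "h \<in> {g \<in> Lp_space \<mu> p. Lp_norm \<mu> p (\<lambda>x. g x - f x) < e}" using h by simp
  qed (use g in simp)
qed auto

lemma in_Lp_closure_iff:
  assumes "X \<subseteq> Lp_space \<mu> p"
  shows "f \<in> Lp_topology \<mu> p closure_of X \<longleftrightarrow>
    f \<in> Lp_space \<mu> p \<and> (\<forall>e>0. \<exists>g\<in>X. Lp_norm \<mu> p (\<lambda>x. g x - f x) < e)"
proof (intro iffI conjI allI impI)
  assume f: "f \<in> Lp_topology \<mu> p closure_of X"
  then show fp: "f \<in> Lp_space \<mu> p" by (simp add: in_closure_of topspace_Lp_topology)
  fix e :: real assume "0 < e"
  then have "f \<in> {g \<in> Lp_space \<mu> p. Lp_norm \<mu> p (\<lambda>x. g x - f x) < e}"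
    using fp by simp
  with f openin_Lp_ball[OF fp, of e]
  obtain g where "g \<in> X" "g \<in> {g \<in> Lp_space \<mu> p. Lp_norm \<mu> p (\<lambda>x. g x - f x) < e}"
    unfolding in_closure_of by meson
  then show "\<exists>g\<in>X. Lp_norm \<mu> p (\<lambda>x. g x - f x) < e" by auto
next
  assume f: "f \<in> Lp_space \<mu> p \<and> (\<forall>e>0. \<exists>g\<in>X. Lp_norm \<mu> p (\<lambda>x. g x - f x) < e)"
  show "f \<in> Lp_topology \<mu> p closure_of X"
    unfolding in_closure_of topspace_Lp_topology
  proof (intro conjI allI impI)
    fix U assume "f \<in> U \<and> openin (Lp_topology \<mu> p) U"
    then obtain e where e: "e > 0" "\<forall>g\<in>Lp_space \<mu> p. Lp_norm \<mu> p (\<lambda>x. g x - f x) < e \<longrightarrow> g \<in> U"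
      unfolding openin_Lp_topology by meson
    obtain g where g: "g \<in> X" "Lp_norm \<mu> p (\<lambda>x. g x - f x) < e" using f e(1) by meson
    then have "g \<in> U" using e(2) subsetD[OF assms g(1)] by simp
    with g(1) show "\<exists>g. g \<in> X \<and> g \<in> U" by auto
  qed (use f in simp)
qed

lemma limitin_Lp_zero_iff:
  assumes "\<And>n. f n \<in> Lp_space \<mu> p"
  shows "limitin (Lp_topology \<mu> p) f (\<lambda>x. 0) F \<longleftrightarrow> ((\<lambda>n. Lp_norm \<mu> p (f n)) \<longlongrightarrow> 0) F"
proof
  assume lim: "limitin (Lp_topology \<mu> p) f (\<lambda>x. 0) F"
  show "((\<lambda>n. Lp_norm \<mu> p (f n)) \<longlongrightarrow> 0) F"
  proof (rule tendstoI)
    fix e :: real assume "0 < e"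
    then have "(\<lambda>x. 0) \<in> {g \<in> Lp_space \<mu> p. Lp_norm \<mu> p (\<lambda>x. g x - 0) < e}"
      by simp
    then have "eventually (\<lambda>n. f n \<in> {g \<in> Lp_space \<mu> p. Lp_norm \<mu> p (\<lambda>x. g x - 0) < e}) F"
      using lim openin_Lp_ball[OF zero_in_Lp_space, of e] unfolding limitin_def by blast
    then show "eventually (\<lambda>n. dist (Lp_norm \<mu> p (f n)) 0 < e) F" by eventually_elim simp
  qed
next
  assume lim: "((\<lambda>n. Lp_norm \<mu> p (f n)) \<longlongrightarrow> 0) F"
  show "limitin (Lp_topology \<mu> p) f (\<lambda>x. 0) F"
    unfolding limitin_def topspace_Lp_topology
  proof (intro conjI allI impI)
    fix U assume "openin (Lp_topology \<mu> p) U \<and> (\<lambda>x. 0) \<in> U"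
    then obtain e where e: "e > 0" "\<forall>g\<in>Lp_space \<mu> p. Lp_norm \<mu> p (\<lambda>x. g x - 0) < e \<longrightarrow> g \<in> U"
      unfolding openin_Lp_topology by meson
    show "eventually (\<lambda>n. f n \<in> U) F"
      using tendstoD[OF lim e(1)] by eventually_elim (use e(2) assms in auto)
  qed simp
qed

end

section \<open>Closures of solid subspaces\<close>

text \<open>
  Pass to an equivalent finite measure and choose a sequence of indices whose union has the
  largest measure among all countable unions. This supremum is attained, since countably many
  sequences can be merged into one; adding a further \<open>N i\<close> cannot increase it, so \<open>N i\<close>
  exceeds the union by a null set only.
\<close>

lemma (in sigma_finite_measure) essential_union:
  fixes I :: "'i set" and N :: "'i \<Rightarrow> 'a set"
  assumes ne: "I \<noteq> {}" and N [measurable]: "\<And>i. i \<in> I \<Longrightarrow> N i \<in> sets M"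
  obtains s :: "nat \<Rightarrow> 'i" where "\<And>k. s k \<in> I"
    and "\<And>i. i \<in> I \<Longrightarrow> N i - (\<Union>k. N (s k)) \<in> null_sets M"
proof -
  obtain h where h [measurable]: "h \<in> borel_measurable M" and fin: "integral\<^sup>N M h \<noteq> \<infinity>"
    and pos: "\<And>x. x \<in> space M \<Longrightarrow> 0 < h x"
    using Ex_finite_integrable_function by auto
  define \<nu> where "\<nu> = density M h"
  have sets_\<nu> [simp]: "sets \<nu> = sets M" by (simp add: \<nu>_def)
  interpret \<nu>: finite_measure \<nu>
  proof (rule finite_measureI)
    have "emeasure \<nu> (space \<nu>) = integral\<^sup>N M h"
      by (auto simp: \<nu>_def emeasure_density intro!: nn_integral_cong)
    then show "emeasure \<nu> (space \<nu>) \<noteq> \<infinity>" using fin by simp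
  qed
  have null: "B \<in> null_sets M" if "B \<in> sets M" "emeasure \<nu> B = 0" for B
  proof -
    have "B \<in> null_sets \<nu>" using that by (simp add: null_sets_def)
    then have "AE x in M. x \<in> B \<longrightarrow> h x = 0"
      unfolding \<nu>_def by (simp add: null_sets_density_iff)
    with AE_space have "AE x in M. x \<notin> B"
      by eventually_elim (use pos in force)
    then show ?thesis using that(1) by (simp add: AE_iff_null_sets)
  qed
  define S where "S = {s :: nat \<Rightarrow> 'i. \<forall>k. s k \<in> I}"
  define g where "g = (\<lambda>s :: nat \<Rightarrow> 'i. emeasure \<nu> (\<Union>k. N (s k)))"
  obtain i0 where "i0 \<in> I" using ne by blast
  then have "(\<lambda>_. i0) \<in> S" by (simp add: S_def)
  then have "S \<noteq> {}" by blast
  then obtain f :: "nat \<Rightarrow> ennreal" where f: "range f \<subseteq> g ` S" "Sup (g ` S) = Sup (range f)"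
    using ennreal_SUP_countable_SUP[of S g] by auto
  have "\<forall>n. \<exists>t\<in>S. f n = g t" using f(1) by blast
  then obtain t where t: "\<And>n. t n \<in> S" "\<And>n. f n = g (t n)" by metis
  \<comment> \<open>One sequence that runs through all members of all \<open>t n\<close>, and so attains the supremum.\<close>
  define s where "s = (\<lambda>k. case prod_decode k of (n, m) \<Rightarrow> t n m)"
  have s_S: "s \<in> S" using t(1) by (auto simp: S_def s_def split: prod.split)
  have sets: "(\<Union>k. N (r k)) \<in> sets M" if "r \<in> S" for r
    using that by (auto simp: S_def)
  have f_le: "f n \<le> g s" for n
  proof -
    have "(\<Union>k. N (t n k)) \<subseteq> (\<Union>k. N (s k))"
    proof
      fix x assume "x \<in> (\<Union>k. N (t n k))"
      then obtain m where "x \<in> N (t n m)" by blast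
      then have "x \<in> N (s (prod_encode (n, m)))" by (simp add: s_def)
      then show "x \<in> (\<Union>k. N (s k))" by blast
    qed
    then show ?thesis unfolding t(2) g_def using sets[OF s_S] by (intro emeasure_mono) auto
  qed
  then have sup: "g r \<le> g s" if "r \<in> S" for r
  proof -
    have "g r \<le> Sup (g ` S)" using that by (rule SUP_upper)
    also have "\<dots> \<le> g s" unfolding f(2) by (rule SUP_least) (rule f_le)
    finally show ?thesis .
  qed
  show ?thesis
  proof (rule that[of s])
    show "s k \<in> I" for k using s_S by (simp add: S_def)
  next
    fix i assume i: "i \<in> I"
    let ?U = "\<Union>k. N (s k)"
    let ?r = "\<lambda>k. case k of 0 \<Rightarrow> i | Suc k \<Rightarrow> s k"
    have r: "?r \<in> S" using i s_S unfolding S_def by (simp split: nat.split)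
    have "(\<Union>k. N (?r k)) = (N i - ?U) \<union> ?U"
      by (subst UNIV_nat_eq) auto
    then have "emeasure \<nu> ((N i - ?U) \<union> ?U) \<le> emeasure \<nu> ?U"
      using sup[OF r] by (simp add: g_def)
    moreover have "emeasure \<nu> ((N i - ?U) \<union> ?U) = emeasure \<nu> (N i - ?U) + emeasure \<nu> ?U"
      using sets[OF s_S] N[OF i] by (subst plus_emeasure) auto
    ultimately have "emeasure \<nu> ?U + emeasure \<nu> (N i - ?U) \<le> emeasure \<nu> ?U + 0"
      by (simp add: add.commute)
    then have "emeasure \<nu> (N i - ?U) = 0"
      using \<nu>.emeasure_finite[of ?U] unfolding ennreal_add_left_cancel_le by simp
    moreover have "N i - ?U \<in> sets M" using sets[OF s_S] N[OF i] by (rule sets.Diff[rotated])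
    ultimately show "N i - ?U \<in> null_sets M" by (rule null[rotated])
  qed
qed

context Lp_exponent
begin

text \<open>
  The indicator of a part of \<open>M' - M\<close> of finite measure lies in the left space, and membership
  in the right one makes it vanish almost everywhere.
\<close>

lemma Lp_on_subset_imp_subset_ae:
  assumes "sigma_finite_measure \<mu>" and M: "M \<in> sets \<mu>" "M' \<in> sets \<mu>"
    and sub: "Lp_on \<mu> p M' \<subseteq> Lp_on \<mu> p M"
  shows "subset_ae \<mu> M' M"
proof -
  interpret sigma_finite_measure \<mu> by fact
  obtain B :: "nat \<Rightarrow> 'a set" where B: "range B \<subseteq> sets \<mu>" "(\<Union>i. B i) = space \<mu>"
    "\<And>i. emeasure \<mu> (B i) \<noteq> \<infinity>"
    by (rule sigma_finite) (rule that)
  have "(M' - M) \<inter> B i \<in> null_sets \<mu>" for i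
  proof -
    let ?D = "(M' - M) \<inter> B i"
    define f where "f = (indicator ?D :: 'a \<Rightarrow> complex)"
    have D: "?D \<in> sets \<mu>" using M B(1) by (intro sets.Int sets.Diff) auto
    have "emeasure \<mu> ?D < \<infinity>"
      using emeasure_mono[of ?D "B i" \<mu>] B(1) B(3)[of i] by (auto simp: less_top top_unique)
    then have "integrable \<mu> (indicator ?D :: 'a \<Rightarrow> real)"
      using D by (simp add: integrable_real_indicator)
    moreover have "(\<lambda>x. norm (f x) powr p) = indicator ?D"
      by (auto simp: f_def indicator_def fun_eq_iff)
    moreover have "f \<in> borel_measurable \<mu>"
      unfolding f_def using D by (rule borel_measurable_indicator)
    ultimately have "f \<in> Lp_space \<mu> p" by (simp add: Lp_space_def)
    moreover have "AE x in \<mu>. x \<notin> M' \<longrightarrow> f x = 0"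
      by (rule AE_I2) (simp add: f_def)
    ultimately have "f \<in> Lp_on \<mu> p M'" by (simp add: Lp_on_def)
    with sub have "f \<in> Lp_on \<mu> p M" by (rule subsetD)
    then have "AE x in \<mu>. x \<notin> M \<longrightarrow> f x = 0" by (simp add: Lp_on_def)
    then have "AE x in \<mu>. x \<notin> ?D" by eventually_elim (auto simp: f_def indicator_def)
    then show ?thesis using D by (simp add: AE_iff_null_sets)
  qed
  then have "(\<Union>i. (M' - M) \<inter> B i) \<in> null_sets \<mu>" by (intro null_sets_UN)
  moreover have "(\<Union>i. (M' - M) \<inter> B i) = M' - M"
    using sets.sets_into_space[OF M(2)] B(2) by blast
  ultimately show ?thesis by (simp add: subset_ae_def)
qed

text \<open>
  \<open>M\<close> is the essential union of the supports of the members of \<open>X\<close>. Vanishing off \<open>M\<close> survives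
  limits in norm. Conversely, let \<open>g\<close> vanish off \<open>M\<close>, and let \<open>d n\<close> be \<open>n\<close> times the sum of the
  absolute values of the first \<open>n\<close> chosen members. By solidity \<open>d n\<close> belongs to \<open>X\<close>, and so does
  the truncation of \<open>g\<close> to the set where \<open>norm g \<le> d n\<close>. At each point of \<open>M\<close> the functions
  \<open>d n\<close> tend to infinity, so the truncations converge to \<open>g\<close> by dominated convergence.
\<close>

theorem closure_solid_subspace:
  assumes "sigma_finite_measure \<mu>" and X: "X \<subseteq> Lp_space \<mu> p"
    and zero: "(\<lambda>x. 0) \<in> X"
    and add: "\<And>f g. f \<in> X \<Longrightarrow> g \<in> X \<Longrightarrow> (\<lambda>x. f x + g x) \<in> X"
    and solid: "\<And>f g. f \<in> X \<Longrightarrow> g \<in> borel_measurable \<mu> \<Longrightarrow>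
      (\<And>x. x \<in> space \<mu> \<Longrightarrow> norm (g x) \<le> norm (f x)) \<Longrightarrow> g \<in> X"
  obtains s :: "nat \<Rightarrow> 'a \<Rightarrow> complex" where "\<And>k. s k \<in> X"
    and "Lp_topology \<mu> p closure_of X = Lp_on \<mu> p (\<Union>k. {x \<in> space \<mu>. s k x \<noteq> 0})"
proof -
  interpret sigma_finite_measure \<mu> by fact
  have meas [measurable_dest]: "f \<in> borel_measurable \<mu>" if "f \<in> X" for f
    using that X Lp_spaceD by blast
  obtain s :: "nat \<Rightarrow> 'a \<Rightarrow> complex" where s: "\<And>k. s k \<in> X"
    and null: "\<And>f. f \<in> X \<Longrightarrow>
      {x \<in> space \<mu>. f x \<noteq> 0} - (\<Union>k. {x \<in> space \<mu>. s k x \<noteq> 0}) \<in> null_sets \<mu>"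
  proof (rule essential_union[of X "\<lambda>f. {x \<in> space \<mu>. f x \<noteq> 0}"])
    show "{x \<in> space \<mu>. f x \<noteq> 0} \<in> sets \<mu>" if "f \<in> X" for f
      using meas[OF that] by measurable
  qed (use zero in auto)
  define M where "M = (\<Union>k. {x \<in> space \<mu>. s k x \<noteq> 0})"
  have s_meas [measurable]: "s k \<in> borel_measurable \<mu>" for k using meas[OF s] .
  have M [measurable]: "M \<in> sets \<mu>" unfolding M_def by measurable
  have off_M: "AE x in \<mu>. x \<notin> M \<longrightarrow> f x = 0" if "f \<in> X" for f
    using AE_not_in[OF null[OF that, folded M_def]] AE_space by eventually_elim auto
  have sum_closed: "(\<lambda>x. \<Sum>k<n. u k x) \<in> X" if "\<And>k. u k \<in> X" for u and n :: nat
    by (induction n) (use zero that add in auto)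

  have "f \<in> Lp_on \<mu> p M" if f: "f \<in> Lp_topology \<mu> p closure_of X" for f
  proof -
    have fp: "f \<in> Lp_space \<mu> p" and approx: "\<And>e. e > 0 \<Longrightarrow> \<exists>g\<in>X. Lp_norm \<mu> p (\<lambda>x. g x - f x) < e"
      using f in_Lp_closure_iff[OF X] by auto
    note [measurable] = Lp_spaceD[OF fp]
    \<comment> \<open>Off \<open>M\<close>, the error \<open>g - f\<close> of an approximation \<open>g\<close> is \<open>- f\<close>, so the part \<open>u\<close> of \<open>f\<close> off
      \<open>M\<close> is bounded by every approximation error.\<close>
    define u where "u = (\<lambda>x. if x \<in> M then 0 else f x)"
    have u_meas [measurable]: "u \<in> borel_measurable \<mu>" unfolding u_def by measurable
    have "u \<in> Lp_space \<mu> p"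
      by (rule Lp_space_dominated[OF fp]) (auto simp: u_def intro: u_meas)
    have "Lp_norm \<mu> p u \<le> 0"
    proof (rule field_le_epsilon)
      fix e :: real assume "0 < e"
      then obtain g where g: "g \<in> X" "Lp_norm \<mu> p (\<lambda>x. g x - f x) < e" using approx by blast
      have "Lp_norm \<mu> p u \<le> Lp_norm \<mu> p (\<lambda>x. g x - f x)"
      proof (rule Lp_norm_mono)
        show "AE x in \<mu>. norm (u x) \<le> norm (g x - f x)"
          using off_M[OF g(1)] by eventually_elim (auto simp: u_def)
      qed (use g X fp Lp_space_diff in auto)
      then show "Lp_norm \<mu> p u \<le> 0 + e" using g(2) by simp
    qed
    then have "AE x in \<mu>. u x = 0"
      using Lp_norm_eq_0_iff[OF \<open>u \<in> Lp_space \<mu> p\<close>] Lp_norm_nonneg[of u] by simp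
    then have "AE x in \<mu>. x \<notin> M \<longrightarrow> f x = 0" by eventually_elim (auto simp: u_def)
    then show ?thesis using fp by (simp add: Lp_on_def)
  qed
  moreover have "g \<in> Lp_topology \<mu> p closure_of X" if g: "g \<in> Lp_on \<mu> p M" for g
  proof -
    have gp: "g \<in> Lp_space \<mu> p" and g0: "AE x in \<mu>. x \<notin> M \<longrightarrow> g x = 0"
      using g by (auto simp: Lp_on_def)
    note [measurable] = Lp_spaceD[OF gp]
    define v where "v = (\<lambda>n x. \<Sum>k<n. complex_of_real (norm (s k x)))"
    \<comment> \<open>Multiplication by \<open>n\<close> is written as an \<open>n\<close>-fold sum, so that closure of \<open>X\<close> under
      addition yields membership of \<open>d n\<close>.\<close>
    define d where "d = (\<lambda>n x. \<Sum>j<n. v n x)"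
    have abs_s: "(\<lambda>x. complex_of_real (norm (s k x))) \<in> X" for k
      by (rule solid[OF s[of k]]) auto
    have d_X: "d n \<in> X" for n
      unfolding d_def v_def using abs_s by (intro sum_closed)
    note [measurable] = meas[OF d_X]
    have norm_d: "norm (d n x) = real n * (\<Sum>k<n. norm (s k x))" for n x
      by (simp add: d_def v_def norm_mult sum_nonneg flip: of_real_sum)
    define G where "G = (\<lambda>n x. if norm (g x) \<le> norm (d n x) then g x else 0)"
    have G_meas [measurable]: "G n \<in> borel_measurable \<mu>" for n unfolding G_def by measurable
    have G_X: "G n \<in> X" for n
      by (rule solid[OF d_X[of n]]) (auto simp: G_def intro: G_meas)
    have conv: "(\<lambda>n. norm (G n x - g x) powr p) \<longlonglongrightarrow> 0" if x: "x \<in> space \<mu>" "x \<notin> M \<longrightarrow> g x = 0" for x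
    proof (cases "x \<in> M")
      case False
      then show ?thesis using x by (simp add: G_def)
    next
      case True
      then obtain k where k: "s k x \<noteq> 0" by (auto simp: M_def)
      then obtain m :: nat where m: "norm (g x) < real m * norm (s k x)"
        using reals_Archimedean3[of "norm (s k x)"] by (auto simp: zero_less_norm_iff)
      have "norm (G n x - g x) powr p = 0" if n: "n \<ge> max m (Suc k)" for n
      proof -
        have "norm (s k x) \<le> (\<Sum>k<n. norm (s k x))"
          using n by (intro member_le_sum) auto
        then have "real m * norm (s k x) \<le> norm (d n x)"
          unfolding norm_d using n by (intro mult_mono) auto
        then show ?thesis using m by (simp add: G_def)
      qed
      then have "\<forall>\<^sub>F n in sequentially. norm (G n x - g x) powr p = 0"
        unfolding eventually_sequentially by blast
      then show ?thesis by (rule tendsto_eventually)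
    qed
    have "(\<lambda>n. LINT x|\<mu>. norm (G n x - g x) powr p) \<longlonglongrightarrow> (LINT x|\<mu>. 0)"
    proof (rule integral_dominated_convergence)
      show "integrable \<mu> (\<lambda>x. norm (g x) powr p)" by (rule Lp_space_integrable[OF gp])
      show "AE x in \<mu>. (\<lambda>n. norm (G n x - g x) powr p) \<longlonglongrightarrow> 0"
        using g0 AE_space by eventually_elim (rule conv)
      show "AE x in \<mu>. norm (norm (G n x - g x) powr p) \<le> norm (g x) powr p" for n
        using p_pos by (intro AE_I2) (auto simp: G_def)
    qed measurable
    then have lim: "(\<lambda>n. LINT x|\<mu>. norm (G n x - g x) powr p) \<longlonglongrightarrow> 0" by simp
    have "\<exists>f\<in>X. Lp_norm \<mu> p (\<lambda>x. f x - g x) < e" if e: "e > 0" for e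
    proof -
      have "\<forall>\<^sub>F n in sequentially. (LINT x|\<mu>. norm (G n x - g x) powr p) < (e / 2) powr p"
        using order_tendstoD(2)[OF lim, of "(e / 2) powr p"] e by simp
      then obtain n where "(LINT x|\<mu>. norm (G n x - g x) powr p) < (e / 2) powr p"
        by (auto simp: eventually_sequentially)
      then have "Lp_norm \<mu> p (\<lambda>x. G n x - g x) \<le> e / 2"
        using e by (subst Lp_norm_le_iff) simp_all
      then show ?thesis using G_X[of n] e by (intro bexI[of _ "G n"]) simp_all
    qed
    then show ?thesis unfolding in_Lp_closure_iff[OF X] using gp by simp
  qed
  ultimately have "Lp_topology \<mu> p closure_of X = Lp_on \<mu> p M" by blast
  then show ?thesis using that[OF s] unfolding M_def by simp
qed

end

section \<open>Sigma-finiteness on locally compact spaces\<close>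

text \<open>
  By the Lindelof property, countably many of the open sets contained in compact sets cover the
  space. The Hausdorff property makes compact sets closed, hence measurable.
\<close>

lemma sigma_finite_of_second_countable_locally_compact:
  assumes sc: "second_countable \<T>" and lc: "locally_compact_space \<T>" and H: "Hausdorff_space \<T>"
    and sets: "sets \<mu> = sets (sigma (topspace \<T>) {U. openin \<T> U})"
    and fin: "\<And>K. compactin \<T> K \<Longrightarrow> emeasure \<mu> K < \<infinity>"
  shows "sigma_finite_measure \<mu>"
proof
  have sub: "{U. openin \<T> U} \<subseteq> Pow (topspace \<T>)" by (auto dest: openin_subset)
  have space: "space \<mu> = topspace \<T>"
    using sets_eq_imp_space_eq[OF sets] sub by (simp add: space_measure_of)
  have open_sets: "U \<in> sets \<mu>" if "openin \<T> U" for U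
    unfolding sets sets_measure_of[OF sub] using that by (auto intro: sigma_sets.Basic)
  have compact_sets: "K \<in> sets \<mu>" if "compactin \<T> K" for K
  proof -
    have "openin \<T> (topspace \<T> - K)"
      using compactin_imp_closedin[OF H that] by (simp add: closedin_def)
    then have "space \<mu> - (topspace \<T> - K) \<in> sets \<mu>"
      using open_sets by blast
    moreover have "space \<mu> - (topspace \<T> - K) = K"
      using compactin_subset_topspace[OF that] space by blast
    ultimately show ?thesis by simp
  qed
  define \<U> where "\<U> = {U. openin \<T> U \<and> (\<exists>K. compactin \<T> K \<and> U \<subseteq> K)}"
  have "\<Union>\<U> = topspace \<T>"
  proof
    show "\<Union>\<U> \<subseteq> topspace \<T>" unfolding \<U>_def using openin_subset by blast
    show "topspace \<T> \<subseteq> \<Union>\<U>"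
      using lc unfolding \<U>_def locally_compact_space_def by blast
  qed
  then obtain \<V> where \<V>: "countable \<V>" "\<V> \<subseteq> \<U>" "\<Union>\<V> = topspace \<T>"
    using Lindelof_spaceD[OF second_countable_imp_Lindelof_space[OF sc], of \<U>]
    unfolding \<U>_def by auto
  have "emeasure \<mu> U \<noteq> \<infinity>" if U: "U \<in> \<V>" for U
  proof -
    obtain K where K: "compactin \<T> K" "U \<subseteq> K" using U \<V>(2) unfolding \<U>_def by blast
    have "emeasure \<mu> U \<le> emeasure \<mu> K" by (rule emeasure_mono[OF K(2) compact_sets[OF K(1)]])
    also have "\<dots> < \<infinity>" by (rule fin[OF K(1)])
    finally show ?thesis by simp
  qed
  moreover have "\<V> \<subseteq> sets \<mu>" using \<V>(2) open_sets unfolding \<U>_def by blast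
  ultimately show "\<exists>A. countable A \<and> A \<subseteq> sets \<mu> \<and> \<Union> A = space \<mu> \<and> (\<forall>a\<in>A. emeasure \<mu> a \<noteq> \<infinity>)"
    using \<V> space by (intro exI[of _ \<V>]) simp
qed

section \<open>Right translations and Haar measure\<close>

locale haar_weighted_translation = topological_group G \<T> + Lp_exponent \<mu> p
  for G (structure) and \<T> and \<mu> and p +
  fixes a :: 'a and w :: "'a \<Rightarrow> real"
  assumes haar: "right_haar_measure G \<T> \<mu>"
    and a: "a \<in> carrier G"
    and w: "weight \<T> w"
begin

lemma open_subsets: "{U. openin \<T> U} \<subseteq> Pow (topspace \<T>)"
  by (auto dest: openin_subset)

lemma sets_haar: "sets \<mu> = sigma_sets (carrier G) {U. openin \<T> U}"
  using haar open_subsets by (simp add: right_haar_measure_def sets_measure_of topspace_eq)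

lemma space_haar: "space \<mu> = carrier G"
proof -
  have "sets \<mu> = sets (sigma (topspace \<T>) {U. openin \<T> U})"
    using haar by (simp add: right_haar_measure_def)
  from sets_eq_imp_space_eq[OF this] show ?thesis
    using open_subsets by (simp add: space_measure_of topspace_eq)
qed

lemma emeasure_coset: "B \<in> sets \<mu> \<Longrightarrow> b \<in> carrier G \<Longrightarrow> emeasure \<mu> (B #> b) = emeasure \<mu> B"
  using haar by (simp add: right_haar_measure_def)

lemma sets_subset_carrier: "B \<in> sets \<mu> \<Longrightarrow> B \<subseteq> carrier G"
  using sets.sets_into_space space_haar by blast

lemma open_in_sets: "openin \<T> U \<Longrightarrow> U \<in> sets \<mu>"
  unfolding sets_haar by (auto intro: sigma_sets.Basic)

lemma measurable_right_translation:
  assumes b: "b \<in> carrier G"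
  shows "(\<lambda>x. x \<otimes> b) \<in> measurable \<mu> \<mu>"
proof (rule measurable_sigma_sets[OF sets_haar])
  show "{U. openin \<T> U} \<subseteq> Pow (carrier G)" using open_subsets topspace_eq by simp
  show "(\<lambda>x. x \<otimes> b) \<in> space \<mu> \<rightarrow> carrier G" using b by (simp add: space_haar)
  fix U assume "U \<in> {U. openin \<T> U}"
  then have U: "openin \<T> U" by simp
  have "continuous_map \<T> (prod_topology \<T> \<T>) (\<lambda>x. (x, b))"
    using b by (intro continuous_map_pairedI) (simp_all add: topspace_eq)
  from continuous_map_compose[OF this continuous_mult]
  have "continuous_map \<T> \<T> (\<lambda>x. x \<otimes> b)" by (simp add: o_def)
  from openin_continuous_map_preimage[OF this U]
  have "openin \<T> {x \<in> carrier G. x \<otimes> b \<in> U}" by (simp add: topspace_eq)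
  moreover have "(\<lambda>x. x \<otimes> b) -` U \<inter> space \<mu> = {x \<in> carrier G. x \<otimes> b \<in> U}"
    by (auto simp: space_haar)
  ultimately show "(\<lambda>x. x \<otimes> b) -` U \<inter> space \<mu> \<in> sets \<mu>" using open_in_sets by simp
qed

lemma coset_eq_preimage:
  assumes "b \<in> carrier G" "B \<subseteq> carrier G"
  shows "B #> b = {x \<in> carrier G. x \<otimes> inv b \<in> B}"
proof (intro equalityI subsetI)
  fix x assume "x \<in> B #> b"
  then obtain y where "y \<in> B" "x = y \<otimes> b" unfolding r_coset_def by blast
  then show "x \<in> {x \<in> carrier G. x \<otimes> inv b \<in> B}"
    using assms by (auto simp: m_assoc subsetD)
next
  fix x assume x: "x \<in> {x \<in> carrier G. x \<otimes> inv b \<in> B}"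
  then have "x = (x \<otimes> inv b) \<otimes> b" using assms by (simp add: m_assoc)
  then show "x \<in> B #> b" using x unfolding r_coset_def by blast
qed

lemma coset_in_sets:
  assumes "b \<in> carrier G" "B \<in> sets \<mu>"
  shows "B #> b \<in> sets \<mu>"
proof -
  have "(\<lambda>x. x \<otimes> inv b) -` B \<inter> space \<mu> \<in> sets \<mu>"
    using assms by (intro measurable_sets[OF measurable_right_translation]) simp_all
  moreover have "(\<lambda>x. x \<otimes> inv b) -` B \<inter> space \<mu> = B #> b"
    using assms sets_subset_carrier by (auto simp: coset_eq_preimage space_haar)
  ultimately show ?thesis by simp
qed

lemma distr_right_translation:
  assumes b: "b \<in> carrier G"
  shows "distr \<mu> \<mu> (\<lambda>x. x \<otimes> b) = \<mu>"
proof (rule measure_eqI)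
  fix B assume "B \<in> sets (distr \<mu> \<mu> (\<lambda>x. x \<otimes> b))"
  then have B: "B \<in> sets \<mu>" by simp
  have "(\<lambda>x. x \<otimes> b) -` B \<inter> space \<mu> = B #> inv b"
    using b B sets_subset_carrier[OF B] by (subst coset_eq_preimage) (auto simp: space_haar)
  then show "emeasure (distr \<mu> \<mu> (\<lambda>x. x \<otimes> b)) B = emeasure \<mu> B"
    using B b by (simp add: emeasure_distr measurable_right_translation emeasure_coset)
qed simp

lemma AE_right_translation:
  assumes b: "b \<in> carrier G" and "AE x in \<mu>. P x"
  shows "AE x in \<mu>. P (x \<otimes> b)"
proof (rule AE_distrD[OF measurable_right_translation[OF b]])
  show "AE x in distr \<mu> \<mu> (\<lambda>x. x \<otimes> b). P x"
    unfolding distr_right_translation[OF b] by fact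
qed

lemma subset_ae_coset_iff:
  assumes M: "M \<in> sets \<mu>" "M' \<in> sets \<mu>" and b: "b \<in> carrier G"
  shows "subset_ae \<mu> (M #> b) M' \<longleftrightarrow> (AE x in \<mu>. x \<otimes> inv b \<in> M \<longrightarrow> x \<in> M')"
proof -
  have "(M #> b) - M' \<in> sets \<mu>" using coset_in_sets[OF b M(1)] M(2) by simp
  then have "subset_ae \<mu> (M #> b) M' \<longleftrightarrow> (AE x in \<mu>. x \<notin> (M #> b) - M')"
    by (simp add: subset_ae_def AE_iff_null_sets)
  also have "\<dots> \<longleftrightarrow> (AE x in \<mu>. x \<otimes> inv b \<in> M \<longrightarrow> x \<in> M')"
    by (rule AE_cong) (use b sets_subset_carrier[OF M(1)] in \<open>auto simp: coset_eq_preimage space_haar\<close>)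
  finally show ?thesis .
qed

section \<open>Weighted translations and the functions with vanishing orbits\<close>

abbreviation W where "W \<equiv> weighted_translation G a w"

lemma weight_measurable: "w \<in> borel_measurable \<mu>"
proof (rule borel_measurableI)
  fix S :: "real set" assume "open S"
  moreover have "continuous_map \<T> euclideanreal w" using w by (simp add: weight_def)
  ultimately have "openin \<T> {x \<in> topspace \<T>. w x \<in> S}"
    by (intro openin_continuous_map_preimage) auto
  moreover have "w -` S \<inter> space \<mu> = {x \<in> topspace \<T>. w x \<in> S}"
    by (auto simp: space_haar topspace_eq)
  ultimately show "w -` S \<inter> space \<mu> \<in> sets \<mu>" using open_in_sets by simp
qed

lemma weight_pos: "x \<in> carrier G \<Longrightarrow> 0 < w x"
  using w by (simp add: weight_def topspace_eq)

lemma weight_bounded: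
  obtains C where "0 < C" "\<And>x. x \<in> carrier G \<Longrightarrow> w x \<le> C"
proof -
  have "bounded (w ` carrier G)" using w by (simp add: weight_def topspace_eq)
  then obtain C where C: "0 < C" "\<forall>y \<in> w ` carrier G. norm y \<le> C"
    unfolding bounded_pos by blast
  show ?thesis
  proof (rule that[OF C(1)])
    fix x assume "x \<in> carrier G"
    then have "\<bar>w x\<bar> \<le> C" using C(2) by simp
    then show "w x \<le> C" by simp
  qed
qed

lemma W_measurable:
  assumes "f \<in> borel_measurable \<mu>"
  shows "W f \<in> borel_measurable \<mu>"
proof -
  have "(\<lambda>x. f (x \<otimes> inv a)) \<in> borel_measurable \<mu>"
    by (rule measurable_compose[OF measurable_right_translation assms]) (simp add: a)
  then show ?thesis
    unfolding weighted_translation_def using weight_measurable by measurable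
qed

lemma W_cong_AE:
  assumes "AE x in \<mu>. f x = g x"
  shows "AE x in \<mu>. W f x = W g x"
  using AE_right_translation[OF inv_closed[OF a] assms]
  by eventually_elim (simp add: weighted_translation_def)

lemma funpow_W_cong_AE:
  assumes "AE x in \<mu>. f x = g x"
  shows "AE x in \<mu>. (W ^^ n) f x = (W ^^ n) g x"
  by (induction n) (use assms in \<open>simp_all add: W_cong_AE\<close>)

lemma W_bounded:
  obtains C where "0 < C" "\<And>f. f \<in> Lp_space \<mu> p \<Longrightarrow> W f \<in> Lp_space \<mu> p"
    "\<And>f. f \<in> Lp_space \<mu> p \<Longrightarrow> Lp_norm \<mu> p (W f) \<le> C * Lp_norm \<mu> p f"
proof -
  obtain C where C: "0 < C" "\<And>x. x \<in> carrier G \<Longrightarrow> w x \<le> C"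
    using weight_bounded by blast
  have "W f \<in> Lp_space \<mu> p \<and> Lp_norm \<mu> p (W f) \<le> C * Lp_norm \<mu> p f"
    if f: "f \<in> Lp_space \<mu> p" for f
  proof -
    let ?g = "\<lambda>x. f (x \<otimes> inv a)"
    note shift = measurable_right_translation[OF inv_closed[OF a]]
    have distr: "distr \<mu> \<mu> (\<lambda>x. x \<otimes> inv a) = \<mu>"
      by (rule distr_right_translation) (simp add: a)
    have g_meas: "?g \<in> borel_measurable \<mu>"
      by (rule measurable_compose[OF shift Lp_spaceD[OF f]])
    have fp_meas: "(\<lambda>x. norm (f x) powr p) \<in> borel_measurable \<mu>"
      using Lp_spaceD[OF f] by measurable
    have "integrable (distr \<mu> \<mu> (\<lambda>x. x \<otimes> inv a)) (\<lambda>x. norm (f x) powr p)"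
      unfolding distr by (rule Lp_space_integrable[OF f])
    then have "integrable \<mu> (\<lambda>x. norm (?g x) powr p)"
      by (rule integrable_distr[OF shift])
    then have g: "?g \<in> Lp_space \<mu> p" using g_meas by (simp add: Lp_space_def)
    have "(LINT x|\<mu>. norm (?g x) powr p) = (LINT x|\<mu>. norm (f x) powr p)"
      using integral_distr[OF shift fp_meas] unfolding distr by simp
    then have norm_g: "Lp_norm \<mu> p ?g = Lp_norm \<mu> p f" by (simp add: Lp_norm_def)
    let ?h = "\<lambda>x. complex_of_real C * ?g x"
    have h: "?h \<in> Lp_space \<mu> p" by (rule Lp_space_scale[OF g])
    have le: "AE x in \<mu>. norm (W f x) \<le> norm (?h x)"
    proof (rule AE_I2)
      fix x assume "x \<in> space \<mu>"
      then have "\<bar>w x\<bar> \<le> \<bar>C\<bar>"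
        using C(2)[of x] weight_pos[of x] by (simp add: space_haar)
      then show "norm (W f x) \<le> norm (?h x)"
        by (simp add: weighted_translation_def norm_mult mult_right_mono)
    qed
    note W_meas = W_measurable[OF Lp_spaceD[OF f]]
    have "Lp_norm \<mu> p (W f) \<le> Lp_norm \<mu> p ?h" by (rule Lp_norm_mono[OF h W_meas le])
    also have "\<dots> = C * Lp_norm \<mu> p f" using C(1) by (simp add: Lp_norm_scale norm_g)
    finally show ?thesis using Lp_space_dominated[OF h W_meas le] by simp
  qed
  then show ?thesis using that[OF C(1)] by simp
qed

lemma W_in_Lp_space: "f \<in> Lp_space \<mu> p \<Longrightarrow> W f \<in> Lp_space \<mu> p"
  using W_bounded by metis

lemma funpow_W_in_Lp_space: "f \<in> Lp_space \<mu> p \<Longrightarrow> (W ^^ n) f \<in> Lp_space \<mu> p"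
  by (induction n) (simp_all add: W_in_Lp_space)

lemma X0_iff:
  "f \<in> X0 \<mu> p A W \<longleftrightarrow> f \<in> Lp_space \<mu> p \<and>
    ((\<lambda>n. Lp_norm \<mu> p ((W ^^ n) f)) \<longlongrightarrow> 0) (inf sequentially (principal A))"
proof (cases "f \<in> Lp_space \<mu> p")
  case True
  show ?thesis
    unfolding X0_def using True by (simp add: limitin_Lp_zero_iff[OF funpow_W_in_Lp_space[OF True]])
qed (simp add: X0_def)

lemma X0_subset: "X0 \<mu> p A W \<subseteq> Lp_space \<mu> p"
  by (auto simp: X0_def)

lemma funpow_W_zero: "(W ^^ n) (\<lambda>x. 0) = (\<lambda>x. 0)"
  by (induction n) (simp_all add: weighted_translation_def)

lemma funpow_W_add: "(W ^^ n) (\<lambda>x. f x + g x) = (\<lambda>x. (W ^^ n) f x + (W ^^ n) g x)"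
  by (induction n) (simp_all add: weighted_translation_def distrib_left)

lemma funpow_W_mono:
  assumes "\<And>x. x \<in> carrier G \<Longrightarrow> norm (g x) \<le> norm (f x)" and "x \<in> carrier G"
  shows "norm ((W ^^ n) g x) \<le> norm ((W ^^ n) f x)"
  using assms(2)
proof (induction n arbitrary: x)
  case (Suc n)
  have "x \<otimes> inv a \<in> carrier G" using Suc.prems a by simp
  from Suc.IH[OF this] show ?case
    by (simp add: weighted_translation_def norm_mult mult_left_mono)
qed (use assms in simp)

lemma X0_zero: "(\<lambda>x. 0) \<in> X0 \<mu> p A W"
  by (simp add: X0_iff funpow_W_zero)

lemma X0_add:
  assumes f: "f \<in> X0 \<mu> p A W" and g: "g \<in> X0 \<mu> p A W"
  shows "(\<lambda>x. f x + g x) \<in> X0 \<mu> p A W"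
proof -
  have Lp: "f \<in> Lp_space \<mu> p" "g \<in> Lp_space \<mu> p" using f g X0_subset by blast+
  let ?F = "inf sequentially (principal A)"
  have "((\<lambda>n. Lp_norm \<mu> p ((W ^^ n) f) + Lp_norm \<mu> p ((W ^^ n) g)) \<longlongrightarrow> 0 + 0) ?F"
    using f g unfolding X0_iff by (intro tendsto_add) simp_all
  then have lim: "((\<lambda>n. Lp_norm \<mu> p ((W ^^ n) f) + Lp_norm \<mu> p ((W ^^ n) g)) \<longlongrightarrow> 0) ?F"
    by simp
  have "((\<lambda>n. Lp_norm \<mu> p ((W ^^ n) (\<lambda>x. f x + g x))) \<longlongrightarrow> 0) ?F"
  proof (rule tendsto_sandwich[OF _ _ tendsto_const lim])
    show "\<forall>\<^sub>F n in ?F. Lp_norm \<mu> p ((W ^^ n) (\<lambda>x. f x + g x))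
        \<le> Lp_norm \<mu> p ((W ^^ n) f) + Lp_norm \<mu> p ((W ^^ n) g)"
      unfolding funpow_W_add
      by (intro always_eventually allI Minkowski_inequality funpow_W_in_Lp_space Lp)
  qed simp
  then show ?thesis using Lp by (simp add: X0_iff Lp_space_add)
qed

text \<open>
  This comparison of orbits places three kinds of functions in \<open>X0\<close>: functions dominated by
  \<open>f\<close> (with \<open>C = 1\<close>), the image \<open>W f\<close> (with a bound for \<open>W\<close>), and a preimage of \<open>f\<close> under
  \<open>W\<close> (with a bound for the inverse).
\<close>

lemma X0_norm_dominated:
  assumes f: "f \<in> X0 \<mu> p A W" and g: "g \<in> Lp_space \<mu> p"
    and le: "\<And>n. Lp_norm \<mu> p ((W ^^ n) g) \<le> C * Lp_norm \<mu> p ((W ^^ n) f)"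
  shows "g \<in> X0 \<mu> p A W"
proof -
  let ?F = "inf sequentially (principal A)"
  have "((\<lambda>n. C * Lp_norm \<mu> p ((W ^^ n) f)) \<longlongrightarrow> C * 0) ?F"
    using f unfolding X0_iff by (intro tendsto_mult tendsto_const) simp
  then have lim: "((\<lambda>n. C * Lp_norm \<mu> p ((W ^^ n) f)) \<longlongrightarrow> 0) ?F" by simp
  have "((\<lambda>n. Lp_norm \<mu> p ((W ^^ n) g)) \<longlongrightarrow> 0) ?F"
    by (rule tendsto_sandwich[OF _ _ tendsto_const lim]) (auto intro!: always_eventually le)
  then show ?thesis using g by (simp add: X0_iff)
qed

lemma X0_solid:
  assumes f: "f \<in> X0 \<mu> p A W" and g: "g \<in> borel_measurable \<mu>"
    and le: "\<And>x. x \<in> space \<mu> \<Longrightarrow> norm (g x) \<le> norm (f x)"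
  shows "g \<in> X0 \<mu> p A W"
proof -
  have fp: "f \<in> Lp_space \<mu> p" using f X0_subset by blast
  have gp: "g \<in> Lp_space \<mu> p" by (rule Lp_space_dominated[OF fp g]) (use le in auto)
  have le_n: "Lp_norm \<mu> p ((W ^^ n) g) \<le> Lp_norm \<mu> p ((W ^^ n) f)" for n
  proof (rule Lp_norm_mono)
    show "AE x in \<mu>. norm ((W ^^ n) g x) \<le> norm ((W ^^ n) f x)"
      by (intro AE_I2 funpow_W_mono) (use le in \<open>simp_all add: space_haar\<close>)
  qed (use fp gp in \<open>simp_all add: funpow_W_in_Lp_space Lp_spaceD\<close>)
  show ?thesis
    by (rule X0_norm_dominated[OF f gp, where C = 1]) (simp add: le_n)
qed

lemma W_X0:
  assumes f: "f \<in> X0 \<mu> p A W"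
  shows "W f \<in> X0 \<mu> p A W"
proof -
  obtain C where C: "\<And>f. f \<in> Lp_space \<mu> p \<Longrightarrow> Lp_norm \<mu> p (W f) \<le> C * Lp_norm \<mu> p f"
    using W_bounded by metis
  have fp: "f \<in> Lp_space \<mu> p" using f X0_subset by blast
  show ?thesis
  proof (rule X0_norm_dominated[OF f])
    show "Lp_norm \<mu> p ((W ^^ n) (W f)) \<le> C * Lp_norm \<mu> p ((W ^^ n) f)" for n
      using C[OF funpow_W_in_Lp_space[OF fp]] by (simp add: funpow_swap1)
  qed (rule W_in_Lp_space[OF fp])
qed

text \<open>
  With \<open>S\<close> the inverse and \<open>u = W\<^sup>n (S f)\<close>, the function \<open>u\<close> agrees almost everywhere with
  \<open>S (W u)\<close>, and \<open>W u = W\<^sup>n (W (S f))\<close> with \<open>W\<^sup>n f\<close>. So the norm of \<open>u\<close> is at most a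
  bound for \<open>S\<close> times that of \<open>W\<^sup>n f\<close>, and \<open>S f\<close> belongs to \<open>X0\<close>.
\<close>

lemma X0_preimage:
  assumes inv: "Lp_invertible \<mu> p W" and f: "f \<in> X0 \<mu> p A W"
  obtains g where "g \<in> X0 \<mu> p A W" "AE x in \<mu>. W g x = f x"
proof -
  obtain S where S: "Lp_bounded_operator \<mu> p S"
    and ST: "\<And>f. f \<in> Lp_space \<mu> p \<Longrightarrow> AE x in \<mu>. S (W f) x = f x"
    and TS: "\<And>f. f \<in> Lp_space \<mu> p \<Longrightarrow> AE x in \<mu>. W (S f) x = f x"
    using inv unfolding Lp_invertible_def by blast
  have S_Lp: "S f \<in> Lp_space \<mu> p" if "f \<in> Lp_space \<mu> p" for f
    using S that by (simp add: Lp_bounded_operator_def)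
  obtain C where C: "\<And>f. f \<in> Lp_space \<mu> p \<Longrightarrow> Lp_norm \<mu> p (S f) \<le> C * Lp_norm \<mu> p f"
    using S unfolding Lp_bounded_operator_def by blast
  have fp: "f \<in> Lp_space \<mu> p" using f X0_subset by blast
  have "S f \<in> X0 \<mu> p A W"
  proof (rule X0_norm_dominated[OF f S_Lp[OF fp]])
    fix n
    let ?u = "(W ^^ n) (S f)"
    have u: "?u \<in> Lp_space \<mu> p" by (rule funpow_W_in_Lp_space[OF S_Lp[OF fp]])
    have Tu: "W ?u \<in> Lp_space \<mu> p" by (rule W_in_Lp_space[OF u])
    have "Lp_norm \<mu> p ?u = Lp_norm \<mu> p (S (W ?u))"
      using ST[OF u] by (intro Lp_norm_cong_AE Lp_spaceD S_Lp Tu u) auto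
    also have "\<dots> \<le> C * Lp_norm \<mu> p (W ?u)" by (rule C[OF Tu])
    also have "W ?u = (W ^^ n) (W (S f))" by (rule funpow_swap1)
    also have "Lp_norm \<mu> p \<dots> = Lp_norm \<mu> p ((W ^^ n) f)"
      by (intro Lp_norm_cong_AE Lp_spaceD funpow_W_in_Lp_space funpow_W_cong_AE TS W_in_Lp_space S_Lp fp)
    finally show "Lp_norm \<mu> p ?u \<le> C * Lp_norm \<mu> p ((W ^^ n) f)" .
  qed
  then show ?thesis using that TS[OF fp] by blast
qed

section \<open>Translation invariance of the support\<close>

lemma subset_ae_coset_mult:
  assumes M: "M \<in> sets \<mu>" and b: "b \<in> carrier G" "subset_ae \<mu> (M #> b) M"
    and c: "c \<in> carrier G" "subset_ae \<mu> (M #> c) M"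
  shows "subset_ae \<mu> (M #> (b \<otimes> c)) M"
proof -
  have B: "AE x in \<mu>. x \<otimes> inv b \<in> M \<longrightarrow> x \<in> M"
    using subset_ae_coset_iff[OF M M b(1)] b(2) by simp
  have C: "AE x in \<mu>. x \<otimes> inv c \<in> M \<longrightarrow> x \<in> M"
    using subset_ae_coset_iff[OF M M c(1)] c(2) by simp
  have "AE x in \<mu>. x \<otimes> inv (b \<otimes> c) \<in> M \<longrightarrow> x \<in> M"
    using AE_right_translation[OF inv_closed[OF c(1)] B] C AE_space
  proof eventually_elim
    case (elim x)
    have "x \<otimes> inv (b \<otimes> c) = x \<otimes> inv c \<otimes> inv b"
      using elim(3) b c by (simp add: inv_mult_group m_assoc space_haar)
    then show ?case using elim(1,2) by simp
  qed
  then show ?thesis using subset_ae_coset_iff[OF M M, of "b \<otimes> c"] b c by simp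
qed

lemma subset_ae_coset_one: "M \<in> sets \<mu> \<Longrightarrow> subset_ae \<mu> (M #> \<one>) M"
  by (simp add: subset_ae_def sets_subset_carrier)

lemma subset_ae_coset_pow:
  assumes "M \<in> sets \<mu>" "b \<in> carrier G" "subset_ae \<mu> (M #> b) M"
  shows "subset_ae \<mu> (M #> (b [^] (n::nat))) M"
  by (induction n)
    (use assms in \<open>simp_all add: subset_ae_coset_one subset_ae_coset_mult\<close>)

text \<open>
  Translation by \<open>b\<close> preserves null sets and turns the inclusion of \<open>M #> inv b\<close> in \<open>M\<close> into
  that of \<open>M\<close> in \<open>M #> b\<close>.
\<close>

lemma subset_ae_coset_inverse:
  assumes M: "M \<in> sets \<mu>" and b: "b \<in> carrier G" and sub: "subset_ae \<mu> (M #> inv b) M"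
  shows "subset_ae \<mu> M (M #> b)"
proof -
  have "AE x in \<mu>. x \<otimes> inv (inv b) \<in> M \<longrightarrow> x \<in> M"
    using subset_ae_coset_iff[OF M M, of "inv b"] b sub by simp
  from AE_right_translation[OF inv_closed[OF b] this]
  have "AE x in \<mu>. x \<notin> M - (M #> b)"
    using AE_space
    by eventually_elim
      (use b in \<open>auto simp: coset_eq_preimage[OF b sets_subset_carrier[OF M]] m_assoc space_haar\<close>)
  moreover have "M - (M #> b) \<in> sets \<mu>" using coset_in_sets[OF b M] M by simp
  ultimately show ?thesis by (simp add: subset_ae_def AE_iff_null_sets)
qed

lemma eq_ae_coset_int_pow:
  assumes M: "M \<in> sets \<mu>" and b: "b \<in> carrier G"
    and sub: "subset_ae \<mu> (M #> b) M" "subset_ae \<mu> (M #> inv b) M"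
  shows "eq_ae \<mu> (M #> (b [^] (n::int))) M"
proof -
  have pow: "subset_ae \<mu> (M #> (b [^] k)) M" for k :: int
  proof (cases k)
    case (nonneg m)
    then show ?thesis using subset_ae_coset_pow[OF M b sub(1)] by (simp add: int_pow_int)
  next
    case (neg m)
    have "b [^] k = inv b [^] Suc m"
      unfolding neg using b by (simp only: int_pow_neg_int nat_pow_inv)
    then show ?thesis using subset_ae_coset_pow[OF M inv_closed[OF b] sub(2), of "Suc m"] by simp
  qed
  have "inv (b [^] n) = b [^] (- n)" using b by (simp add: int_pow_neg)
  then have "subset_ae \<mu> M (M #> (b [^] n))"
    using pow[of "- n"] b by (intro subset_ae_coset_inverse[OF M]) simp_all
  then show ?thesis using pow[of n] by (simp add: eq_ae_def)
qed

text \<open>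
  If \<open>x \<otimes> inv a\<close> is in the support of \<open>s k\<close>, then \<open>W (s k)\<close> does not vanish at \<open>x\<close>, as the
  weight is positive; but \<open>W (s k)\<close> is in \<open>X0\<close> and so vanishes almost everywhere off \<open>M\<close>. In the
  invertible case the same reasoning is applied to a preimage \<open>g\<close> of \<open>s k\<close>: up to a positive
  factor, \<open>s k\<close> at \<open>x \<otimes> a\<close> is \<open>g\<close> at \<open>x\<close>.
\<close>

lemma translation_invariant_support:
  assumes s: "\<And>k :: nat. s k \<in> X0 \<mu> p A W"
    and M_def: "M = (\<Union>k. {x \<in> space \<mu>. s k x \<noteq> 0})" and M: "M \<in> sets \<mu>"
    and off: "\<And>f. f \<in> X0 \<mu> p A W \<Longrightarrow> AE x in \<mu>. x \<notin> M \<longrightarrow> f x = 0"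
  shows "subset_ae \<mu> (M #> a) M"
    and "Lp_invertible \<mu> p W \<Longrightarrow> subset_ae \<mu> (M #> inv a) M"
proof -
  have "AE x in \<mu>. \<forall>k. x \<notin> M \<longrightarrow> W (s k) x = 0"
    unfolding AE_all_countable using off[OF W_X0[OF s]] by blast
  with AE_space have "AE x in \<mu>. x \<otimes> inv a \<in> M \<longrightarrow> x \<in> M"
  proof eventually_elim
    case (elim x)
    then have "w x \<noteq> 0" using weight_pos[of x] by (simp add: space_haar)
    then show ?case using elim(2) by (auto simp: M_def weighted_translation_def)
  qed
  then show "subset_ae \<mu> (M #> a) M" using subset_ae_coset_iff[OF M M a] by simp
next
  assume inv: "Lp_invertible \<mu> p W"
  have "AE x in \<mu>. x \<notin> M \<longrightarrow> s k (x \<otimes> a) = 0" for k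
  proof -
    obtain g where g: "g \<in> X0 \<mu> p A W" "AE x in \<mu>. W g x = s k x"
      using X0_preimage[OF inv s] by blast
    from AE_right_translation[OF a g(2)] off[OF g(1)] AE_space show ?thesis
      by eventually_elim (auto simp: weighted_translation_def m_assoc a space_haar)
  qed
  then have "AE x in \<mu>. \<forall>k. x \<notin> M \<longrightarrow> s k (x \<otimes> a) = 0"
    unfolding AE_all_countable by blast
  then have "AE x in \<mu>. x \<otimes> inv (inv a) \<in> M \<longrightarrow> x \<in> M"
    by eventually_elim (auto simp: M_def a)
  then show "subset_ae \<mu> (M #> inv a) M"
    using subset_ae_coset_iff[OF M M inv_closed[OF a]] by simp
qed

end

section \<open>The closure of the space of functions with vanishing orbits\<close>

theorem theorem3p14:
  fixes G :: "('a, 'b) monoid_scheme" and \<T> :: "'a topology" and \<mu> :: "'a measure"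
    and p :: real and a :: 'a and w :: "'a \<Rightarrow> real" and A :: "nat set"
  assumes "topological_group G \<T>"
    and "second_countable \<T>" and "locally_compact_space \<T>" and "Hausdorff_space \<T>"
    and "right_haar_measure G \<T> \<mu>"
    and "1 \<le> p"
    and "a \<in> carrier G" and "weight \<T> w"
    and "A \<subseteq> {1..}" and "upper_density A = 1"
  defines "T \<equiv> weighted_translation G a w"
  shows "\<exists>M \<in> sets \<mu>.
           Lp_topology \<mu> p closure_of X0 \<mu> p A T = Lp_on \<mu> p M \<and>
           (\<forall>M' \<in> sets \<mu>. Lp_topology \<mu> p closure_of X0 \<mu> p A T = Lp_on \<mu> p M' \<longrightarrow> eq_ae \<mu> M' M) \<and>
           (\<forall>n::nat. 1 \<le> n \<longrightarrow> subset_ae \<mu> (M #>\<^bsub>G\<^esub> (a [^]\<^bsub>G\<^esub> n)) M) \<and>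
           (Lp_invertible \<mu> p T \<longrightarrow> (\<forall>n::int. eq_ae \<mu> (M #>\<^bsub>G\<^esub> (a [^]\<^bsub>G\<^esub> n)) M))"
proof -
  interpret haar_weighted_translation G \<T> \<mu> p a w
    using assms by (simp add: haar_weighted_translation_def haar_weighted_translation_axioms_def
        Lp_exponent_def)
  have sf: "sigma_finite_measure \<mu>"
    using assms(2-5) unfolding right_haar_measure_def
    by (intro sigma_finite_of_second_countable_locally_compact) auto
  let ?X = "X0 \<mu> p A (weighted_translation G a w)"
  obtain s :: "nat \<Rightarrow> 'a \<Rightarrow> complex" where s: "\<And>k. s k \<in> ?X"
    and closure: "Lp_topology \<mu> p closure_of ?X = Lp_on \<mu> p (\<Union>k. {x \<in> space \<mu>. s k x \<noteq> 0})"
  proof (rule closure_solid_subspace[OF sf X0_subset[of A] X0_zero[of A]])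
    show "(\<lambda>x. f x + g x) \<in> ?X" if "f \<in> ?X" "g \<in> ?X" for f g
      using that by (rule X0_add)
    show "g \<in> ?X" if "f \<in> ?X" "g \<in> borel_measurable \<mu>"
      "\<And>x. x \<in> space \<mu> \<Longrightarrow> norm (g x) \<le> norm (f x)" for f g
      using that by (rule X0_solid)
  qed (rule that)
  define M where "M = (\<Union>k. {x \<in> space \<mu>. s k x \<noteq> 0})"
  have closure_M: "Lp_topology \<mu> p closure_of ?X = Lp_on \<mu> p M"
    using closure by (simp add: M_def)
  have "{x \<in> space \<mu>. s k x \<noteq> 0} \<in> sets \<mu>" for k
  proof -
    have "s k \<in> borel_measurable \<mu>"
      by (rule Lp_spaceD[OF subsetD[OF X0_subset s]])
    then show ?thesis by measurable
  qed
  then have M: "M \<in> sets \<mu>" unfolding M_def by (intro sets.countable_UN) auto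
  have off: "AE x in \<mu>. x \<notin> M \<longrightarrow> f x = 0" if f: "f \<in> ?X" for f
  proof -
    have "?X \<subseteq> Lp_topology \<mu> p closure_of ?X"
      by (rule closure_of_subset) (simp add: X0_subset topspace_Lp_topology)
    then have "f \<in> Lp_on \<mu> p M" using f closure_M by auto
    then show ?thesis by (simp add: Lp_on_def)
  qed
  have forward: "subset_ae \<mu> (M #>\<^bsub>G\<^esub> a) M"
    by (rule translation_invariant_support(1)[OF s M_def M off])
  have backward: "subset_ae \<mu> (M #>\<^bsub>G\<^esub> inv\<^bsub>G\<^esub> a) M"
    if "Lp_invertible \<mu> p (weighted_translation G a w)"
    by (rule translation_invariant_support(2)[OF s M_def M off that])
  show ?thesis
    unfolding T_def
  proof (intro bexI[OF _ M] conjI ballI impI allI)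
    fix M' assume "M' \<in> sets \<mu>" "Lp_topology \<mu> p closure_of ?X = Lp_on \<mu> p M'"
    then show "eq_ae \<mu> M' M"
      using Lp_on_subset_imp_subset_ae[OF sf] M closure_M by (simp add: eq_ae_def)
  next
    fix n :: nat
    show "subset_ae \<mu> (M #>\<^bsub>G\<^esub> (a [^]\<^bsub>G\<^esub> n)) M"
      by (rule subset_ae_coset_pow[OF M a forward])
  next
    fix n :: int assume "Lp_invertible \<mu> p (weighted_translation G a w)"
    from backward[OF this] show "eq_ae \<mu> (M #>\<^bsub>G\<^esub> (a [^]\<^bsub>G\<^esub> n)) M"
      by (rule eq_ae_coset_int_pow[OF M a forward])
  qed (rule closure_M)
qed

end
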